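(* Let $m>3$. Promotion $\partial$ acting on $\mathrm{SYT}_R(1,m-2,1)$ has order $(m-1)(m-2)$, with exactly one orbit of size $m-2$ and $m-3$ orbits of size $m-1$. Consequently, with $\psi_m(q,t)=[m-2]_t+(m-3)[m-1]_q$, $\xi$ a primitive $(m-1)$-th root of unity and $\zeta$ a primitive $(m-2)$-th root of unity, for all integers $r,s$, \[ \psi_m(\xi^r,\zeta^s)=\#\{T\in\mathrm{SYT}_R(1,m-2,1):\partial^{r(m-2)+s(m-1)}(T)=T\}; \] i.e. $(\mathrm{SYT}_R(1,m-2,1),\langle\partial^{m-1}\rangle\times\langle\partial^{m-2}\rangle,\psi_m(q,t))$ exhibits the bicyclic sieving phenomenon.
   Context: $\mathrm{SYT}_R(1,m-2,1)$ is the set of standard Young tableaux with entries $1,\dots,m$ of the three-row ribbon shape consisting of a single box in the top row, $m-2$ boxes in the middle row and a single box in the bottom row, where the top box lies directly above the last box of the middle row and the bottom box lies directly below the first box of the middle row. Promotion $\partial$: replace $1$ by a dot; repeatedly swap the dot with the smaller of its right and lower neighbours in the shape until neither exists; decrement all entries by one and put $m$ in the dot's box. $[r]_q=1+q+\dots+q^{r-1}$. Bicyclic sieving for cyclic groups $\langle c_1\rangle,\langle c_2\rangle$ of orders $k_1,k_2$ acting on $X$ with polynomial $f(q,t)$ means $f(\zeta_1^i,\zeta_2^j)=\#\{x:c_1^ic_2^jx=x\}$ for all integers $i,j$, with $\zeta_1,\zeta_2$ primitive $k_1$-th and $k_2$-th roots of unity.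
   Formalization: In the final bicyclic sieving triple the two factors are taken in the order ⟨∂^{m−2}⟩×⟨∂^{m−1}⟩, so that q goes with ∂^{m−2} (order m−1) and t with ∂^{m−1} (order m−2), as the displayed formula requires; the printed order, read literally, fails (e.g. m=4). *)

theory Defs
  imports
    Complex_Main
    "HOL-Library.While_Combinator"
    "HOL-Algebra.Elementary_Groups"
    "HOL-Algebra.Multiplicative_Group"
    "HOL-Algebra.Group_Action"
    "HOL-Computational_Algebra.Polynomial"
begin

text \<open>Cells are pairs (row, column), indexed from 0, with rows numbered from top to bottom
  (English convention).\<close>

type_synonym cell = "nat \<times> nat"
type_synonym tableau = "cell \<Rightarrow> nat"

text \<open>Tableaux of shape \<open>D\<close> are extensional functions, so that equality of functions is equality
  of tableaux and the number of tableaux is the cardinality of the set below.\<close>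

definition SYT :: "cell set \<Rightarrow> tableau set" where
  "SYT D = {T \<in> extensional D.
     bij_betw T D {1..card D} \<and>
     (\<forall>i j j'. (i, j) \<in> D \<longrightarrow> (i, j') \<in> D \<longrightarrow> j < j' \<longrightarrow> T (i, j) < T (i, j')) \<and>
     (\<forall>i i' j. (i, j) \<in> D \<longrightarrow> (i', j) \<in> D \<longrightarrow> i < i' \<longrightarrow> T (i, j) < T (i', j))}"

definition right_lower_neighbours :: "cell set \<Rightarrow> cell \<Rightarrow> cell set" where
  "right_lower_neighbours D d = {(fst d, Suc (snd d)), (Suc (fst d), snd d)} \<inter> D"

text \<open>A state \<open>(T, d)\<close> is a filling with the dot in cell \<open>d\<close>; the value \<open>T d\<close> is irrelevant.\<close>

definition slide_step :: "cell set \<Rightarrow> tableau \<times> cell \<Rightarrow> tableau \<times> cell" where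
  "slide_step D = (\<lambda>(T, d).
     let n = arg_min_on T (right_lower_neighbours D d) in (T(d := T n), n))"

definition slide :: "cell set \<Rightarrow> tableau \<times> cell \<Rightarrow> tableau \<times> cell" where
  "slide D = while (\<lambda>(T, d). right_lower_neighbours D d \<noteq> {}) (slide_step D)"

definition promotion :: "cell set \<Rightarrow> tableau \<Rightarrow> tableau" where
  "promotion D T =
     (let (T', d) = slide D (T, the_inv_into D T 1)
      in (\<lambda>c\<in>D. if c = d then card D else T' c - 1))"

definition ribbon :: "nat \<Rightarrow> cell set" where
  "ribbon m = {(0, m - 3)} \<union> {(1, j) | j. j < m - 2} \<union> {(2, 0)}"

definition SYT_R :: "nat \<Rightarrow> tableau set" where
  "SYT_R m = SYT (ribbon m)"

text \<open>Promotion restricted to the tableaux of ribbon shape, in the form of an element of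
  \<^term>\<open>BijGroup (SYT_R m)\<close>.\<close>

definition ribbon_promotion :: "nat \<Rightarrow> tableau \<Rightarrow> tableau" where
  "ribbon_promotion m = restrict (promotion (ribbon m)) (SYT_R m)"

definition q_int :: "nat \<Rightarrow> 'a::comm_ring_1 poly" where
  "q_int r = (\<Sum>i<r. [:0, 1:] ^ i)"

text \<open>A bivariate integer polynomial in \<open>q\<close> and \<open>t\<close> is a polynomial in the outer variable \<open>q\<close>
  whose coefficients are polynomials in the inner variable \<open>t\<close>.\<close>

definition eval2 :: "int poly poly \<Rightarrow> complex \<Rightarrow> complex \<Rightarrow> complex" where
  "eval2 f q t = poly (map_poly (\<lambda>p. poly (map_poly of_int p) t) f) q"

definition psi :: "nat \<Rightarrow> int poly poly" where
  "psi m = [:q_int (m - 2):] + of_nat (m - 3) * q_int (m - 1)"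

definition primitive_root_of_unity :: "nat \<Rightarrow> complex \<Rightarrow> bool" where
  "primitive_root_of_unity k z \<longleftrightarrow> 0 < k \<and> z ^ k = 1 \<and> (\<forall>j. 0 < j \<and> j < k \<longrightarrow> z ^ j \<noteq> 1)"

text \<open>\<open>G\<close> and \<open>H\<close> are finite cyclic groups with generators \<open>c\<close> and \<open>d\<close>, and \<open>\<phi>\<close> is an action
  of their product on \<open>X\<close>.  The variable \<open>q\<close> belongs to \<open>G\<close>, the variable \<open>t\<close> to \<open>H\<close>.\<close>

definition bicyclic_sieving ::
  "('g, 'u) monoid_scheme \<Rightarrow> 'g \<Rightarrow> ('h, 'v) monoid_scheme \<Rightarrow> 'h \<Rightarrow>
   'x set \<Rightarrow> ('g \<times> 'h \<Rightarrow> 'x \<Rightarrow> 'x) \<Rightarrow> int poly poly \<Rightarrow> bool" where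
  "bicyclic_sieving G c H d X \<phi> f \<longleftrightarrow>
     group G \<and> finite (carrier G) \<and> c \<in> carrier G \<and> subgroup_generated G {c} = G \<and>
     group H \<and> finite (carrier H) \<and> d \<in> carrier H \<and> subgroup_generated H {d} = H \<and>
     finite X \<and> group_action (G \<times>\<times> H) X \<phi> \<and>
     (\<forall>\<xi> \<zeta>. primitive_root_of_unity (Coset.order G) \<xi> \<longrightarrow>
            primitive_root_of_unity (Coset.order H) \<zeta> \<longrightarrow>
       (\<forall>i j :: int.
          eval2 f (\<xi> powi i) (\<zeta> powi j) =
          of_nat (card {x \<in> X. \<phi> (c [^]\<^bsub>G\<^esub> i, d [^]\<^bsub>H\<^esub> j) x = x})))"

end

theory Submission
  imports Defs
begin

text \<open>A tableau of the ribbon shape is determined by its top entry \<open>a\<close> and its bottom entry \<open>c\<close>,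
  where \<open>1 \<le> a < m\<close>, \<open>2 \<le> c \<le> m\<close>, \<open>a \<noteq> c\<close> and \<open>(a, c)\<close> is neither \<open>(1, 2)\<close> nor \<open>(m - 1, m)\<close>.
  On these pairs promotion decreases both coordinates by one modulo \<open>m - 1\<close>, with \<open>a\<close> read in
  \<open>{1..m - 1}\<close> and \<open>c\<close> in \<open>{2..m}\<close>, except on the cycle
  \<open>(1, m), (m - 2, m - 1), (m - 3, m - 2), \<dots>, (2, 3)\<close> of length \<open>m - 2\<close>.  Off this cycle the
  difference \<open>c - a\<close> modulo \<open>m - 1\<close> is invariant and takes the \<open>m - 3\<close> values \<open>2, \<dots>, m - 2\<close>, each
  on one orbit of size \<open>m - 1\<close>.  The sieving identity then compares divisibility with sums of powers of
  a root of unity.\<close>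

section \<open>Ribbon tableaux and their end pairs\<close>

text \<open>The \<open>j\<close>-th smallest positive integer other than \<open>a\<close> and \<open>c\<close>, counted from \<open>j = 0\<close>.\<close>

definition mid_entry :: "nat \<Rightarrow> nat \<Rightarrow> nat \<Rightarrow> nat" where
  "mid_entry a c j =
     (if j + 1 < min a c then j + 1 else if j + 2 < max a c then j + 2 else j + 3)"

definition ribbon_tableau :: "nat \<Rightarrow> nat \<times> nat \<Rightarrow> tableau" where
  "ribbon_tableau m = (\<lambda>(a, c). \<lambda>x\<in>ribbon m.
     if fst x = 0 then a else if fst x = 2 then c else mid_entry a c (snd x))"

text \<open>The column conditions compare \<open>a\<close> with the largest middle entry and
  \<open>c\<close> with the smallest. The first fails only for \<open>a = m\<close> and for the pair
  \<open>(m - 1, m)\<close>, the second only for \<open>c = 1\<close> and for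
  \<open>(1, 2)\<close>.\<close>

definition end_pairs :: "nat \<Rightarrow> (nat \<times> nat) set" where
  "end_pairs m = {(a, c). 1 \<le> a \<and> a < m \<and> 2 \<le> c \<and> c \<le> m \<and> a \<noteq> c \<and>
     (a, c) \<noteq> (m - 1, m) \<and> (a, c) \<noteq> (1, 2)}"

text \<open>The cases are the paths of the dot. For \<open>a = 1\<close> it starts on top and drops
  to the end of the middle row, whose last entry is \<open>m\<close>, or \<open>m - 1\<close> if
  \<open>c = m\<close>. Otherwise it starts at the first middle box; it moves down exactly when
  \<open>c\<close> is below the second middle entry, that is, for \<open>c = 2\<close> or
  \<open>(2, 3)\<close>, and else runs along the row.\<close>

definition pair_promotion :: "nat \<Rightarrow> nat \<times> nat \<Rightarrow> nat \<times> nat" where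
  "pair_promotion m = (\<lambda>(a, c).
     if a = 1 then (if c = m then (m - 2, m - 1) else (m - 1, c - 1))
     else if c = 2 then (a - 1, m)
     else if a = 2 \<and> c = 3 then (1, m)
     else (a - 1, c - 1))"

lemma mem_ribbon:
  "x \<in> ribbon m \<longleftrightarrow> x = (0, m - 3) \<or> (fst x = 1 \<and> snd x < m - 2) \<or> x = (2, 0)"
  by (cases x) (auto simp: ribbon_def)

lemma finite_ribbon: "finite (ribbon m)"
  by (simp add: ribbon_def)

lemma ribbon_eq_insert: "ribbon m = insert (0, m - 3) (insert (2, 0) (Pair 1 ` {..<m - 2}))"
  by (auto simp: mem_ribbon)

lemma card_ribbon:
  assumes "m > 3"
  shows "card (ribbon m) = m"
proof -
  have "card (Pair (1::nat) ` {..<m - 2}) = m - 2"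
    by (subst card_image) (auto simp: inj_on_def)
  then show ?thesis
    using assms by (auto simp: ribbon_eq_insert card_insert_if)
qed

lemma strict_mono_mid_entry:
  assumes "i < j"
  shows "mid_entry a c i < mid_entry a c j"
  using assms by (auto simp: mid_entry_def)

lemma mid_entry_Suc: "mid_entry (Suc a) (Suc c) (Suc j) = Suc (mid_entry a c j)"
  by (simp add: mid_entry_def)

text \<open>Strict monotonicity makes both sides have \<open>m - 2\<close> elements, so one
  inclusion is enough and no preimages are needed.\<close>

lemma mid_entry_image:
  assumes "a \<noteq> c" "a \<in> {1..m}" "c \<in> {1..m}"
  shows "mid_entry a c ` {..<m - 2} = {1..m} - {a, c}"
proof (rule card_subset_eq)
  have "inj_on (mid_entry a c) {..<m - 2}"
    by (rule linorder_inj_onI') (metis less_irrefl strict_mono_mid_entry)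
  then have "card (mid_entry a c ` {..<m - 2}) = m - 2"
    by (simp add: card_image)
  then show "card (mid_entry a c ` {..<m - 2}) = card ({1..m} - {a, c})"
    using assms by (subst card_Diff_subset) auto
  show "mid_entry a c ` {..<m - 2} \<subseteq> {1..m} - {a, c}"
    using assms by (auto simp: mid_entry_def min_def max_def split: if_splits)
qed auto

lemma ribbon_tableau_top: "ribbon_tableau m (a, c) (0, m - 3) = a"
  and ribbon_tableau_bottom: "ribbon_tableau m (a, c) (2, 0) = c"
  and ribbon_tableau_middle:
    "j < m - 2 \<Longrightarrow> ribbon_tableau m (a, c) (1, j) = mid_entry a c j"
  by (auto simp: ribbon_tableau_def mem_ribbon)

lemma ribbon_tableau_in_SYT_R:
  assumes "m > 3" "(a, c) \<in> end_pairs m"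
  shows "ribbon_tableau m (a, c) \<in> SYT_R m"
proof -
  let ?T = "ribbon_tableau m (a, c)"
  have ac: "1 \<le> a" "a < m" "2 \<le> c" "c \<le> m" "a \<noteq> c"
    "\<not> (a = m - 1 \<and> c = m)" "\<not> (a = 1 \<and> c = 2)"
    using assms(2) by (simp_all add: end_pairs_def)
  have "?T ` ribbon m = insert a (insert c (mid_entry a c ` {..<m - 2}))"
  proof -
    have "?T ` Pair 1 ` {..<m - 2} = mid_entry a c ` {..<m - 2}"
      unfolding image_image by (rule image_cong) (simp_all only: ribbon_tableau_middle lessThan_iff)
    then show ?thesis
      by (simp only: ribbon_eq_insert image_insert ribbon_tableau_top ribbon_tableau_bottom)
  qed
  also have "\<dots> = {1..m}"
    using ac by (subst mid_entry_image) auto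
  finally have "?T ` ribbon m = {1..m}" .
  moreover from this have "inj_on ?T (ribbon m)"
    by (intro eq_card_imp_inj_on finite_ribbon) (simp add: card_ribbon[OF assms(1)])
  ultimately have "bij_betw ?T (ribbon m) {1..card (ribbon m)}"
    by (simp add: bij_betw_def card_ribbon[OF assms(1)])
  moreover have "?T \<in> extensional (ribbon m)"
    by (simp add: ribbon_tableau_def)
  moreover have "?T (i, j) < ?T (i, j')"
    if "(i, j) \<in> ribbon m" "(i, j') \<in> ribbon m" "j < j'" for i j j'
    using that strict_mono_mid_entry[OF that(3), of a c]
    by (auto simp: ribbon_tableau_def mem_ribbon)
  moreover have "?T (i, j) < ?T (i', j)"
    if "(i, j) \<in> ribbon m" "(i', j) \<in> ribbon m" "i < i'" for i i' j
  proof -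
    \<comment> \<open>Since \<open>m > 3\<close>, the top and bottom boxes lie in different columns,
      so these two inequalities are all that the columns require.\<close>
    have "a < mid_entry a c (m - 3)" "mid_entry a c 0 < c"
      using ac assms(1) by (auto simp: mid_entry_def min_def max_def)
    then show ?thesis
      using that assms(1) by (auto simp: ribbon_tableau_def mem_ribbon)
  qed
  ultimately show ?thesis
    by (auto simp: SYT_R_def SYT_def)
qed

text \<open>The middle row and \<open>mid_entry a c\<close> list the same set
  \<open>{1..m} - {a, c}\<close> in increasing order, and a strictly sorted list is determined by
  its set.\<close>

lemma SYT_R_obtain_pair:
  assumes "m > 3" "T \<in> SYT_R m"
  obtains x where "x \<in> end_pairs m" "T = ribbon_tableau m x"
proof -
  define a c where "a = T (0, m - 3)" and "c = T (2, 0)"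
  have ext: "T \<in> extensional (ribbon m)" and bij: "bij_betw T (ribbon m) {1..m}"
    and row: "\<And>i j j'. (i, j) \<in> ribbon m \<Longrightarrow> (i, j') \<in> ribbon m \<Longrightarrow> j < j' \<Longrightarrow>
      T (i, j) < T (i, j')"
    and col: "\<And>i i' j. (i, j) \<in> ribbon m \<Longrightarrow> (i', j) \<in> ribbon m \<Longrightarrow> i < i' \<Longrightarrow>
      T (i, j) < T (i', j)"
    using assms(2) by (auto simp: SYT_R_def SYT_def card_ribbon[OF assms(1)])
  have inj: "inj_on T (ribbon m)" and im: "T ` ribbon m = {1..m}"
    using bij by (auto simp: bij_betw_def)
  have ac: "a \<noteq> c" "a \<in> {1..m}" "c \<in> {1..m}"
  proof -
    have cells: "(0, m - 3) \<in> ribbon m" "(2, 0) \<in> ribbon m" by (simp_all add: mem_ribbon)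
    then show "a \<in> {1..m}" "c \<in> {1..m}"
      unfolding a_def c_def im[symmetric] by simp_all
    show "a \<noteq> c"
      using inj_on_eq_iff[OF inj cells] by (simp add: a_def c_def)
  qed
  let ?f = "\<lambda>j. T (1, j)"
  have less: "?f i < ?f j" if "i < j" "j < m - 2" for i j
    using row[of 1 i j] that by (auto simp: mem_ribbon)
  have "?f ` {..<m - 2} = T ` (ribbon m - {(0, m - 3), (2, 0)})"
  proof -
    have "ribbon m - {(0, m - 3), (2, 0)} = Pair 1 ` {..<m - 2}"
      by (auto simp: mem_ribbon)
    then show ?thesis by (simp add: image_image)
  qed
  also have "\<dots> = T ` ribbon m - T ` {(0, m - 3), (2, 0)}"
    by (rule inj_on_image_set_diff[OF inj]) (auto simp: mem_ribbon)
  also have "\<dots> = {1..m} - {a, c}"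
    by (simp add: im a_def c_def)
  also have "\<dots> = mid_entry a c ` {..<m - 2}"
    using mid_entry_image[OF ac] by simp
  finally have "?f ` {..<m - 2} = mid_entry a c ` {..<m - 2}" .
  then have "map ?f [0..<m - 2] = map (mid_entry a c) [0..<m - 2]"
    by (intro strict_sorted_equal)
      (auto simp: sorted_wrt_iff_nth_less less[unfolded One_nat_def] strict_mono_mid_entry
        atLeast0LessThan)
  then have mid: "T (1, j) = mid_entry a c j" if "j < m - 2" for j
    using that by (simp add: list_eq_iff_nth_eq)
  have "T = ribbon_tableau m (a, c)"
    by (rule extensionalityI[OF ext])
      (auto simp: ribbon_tableau_def mem_ribbon a_def c_def mid[unfolded a_def c_def One_nat_def])
  moreover have "(a, c) \<in> end_pairs m"
  proof -
    have "a < mid_entry a c (m - 3)" "mid_entry a c 0 < c"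
      using col[of 0 "m - 3" 1] col[of 1 0 2] mid[of 0] mid[of "m - 3"] assms(1)
      by (auto simp: mem_ribbon a_def c_def)
    then show ?thesis
      using ac assms(1) by (auto simp: end_pairs_def mid_entry_def min_def max_def split: if_splits)
  qed
  ultimately show ?thesis using that by blast
qed

lemma inj_ribbon_tableau: "inj (ribbon_tableau m)"
proof (rule injI)
  fix x y :: "nat \<times> nat"
  assume "ribbon_tableau m x = ribbon_tableau m y"
  then show "x = y"
    by (cases x; cases y) (metis ribbon_tableau_top ribbon_tableau_bottom)
qed

section \<open>Sliding the dot through the ribbon\<close>

lemma neighbours_top:
  "m > 3 \<Longrightarrow> right_lower_neighbours (ribbon m) (0, m - 3) = {(1, m - 3)}"
  by (auto simp: right_lower_neighbours_def mem_ribbon)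

lemma neighbours_corner:
  "m > 3 \<Longrightarrow> right_lower_neighbours (ribbon m) (1, 0) = {(1, 1), (2, 0)}"
  by (auto simp: right_lower_neighbours_def mem_ribbon)

lemma neighbours_bottom:
  "m > 3 \<Longrightarrow> right_lower_neighbours (ribbon m) (2, 0) = {}"
  by (auto simp: right_lower_neighbours_def mem_ribbon)

lemma neighbours_middle:
  "0 < j \<Longrightarrow> right_lower_neighbours (ribbon m) (1, j) = (if j < m - 3 then {(1, Suc j)} else {})"
  by (auto simp: right_lower_neighbours_def mem_ribbon)

lemma arg_min_on_singleton:
  fixes f :: "'a \<Rightarrow> 'b::order"
  shows "arg_min_on f {x} = x"
  using arg_min_if_finite(1)[of "{x}" f] by simp

lemma arg_min_on_doubleton:
  fixes f :: "'a \<Rightarrow> nat"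
  assumes "f x < f y"
  shows "arg_min_on f {x, y} = x"
  using arg_min_if_finite[of "{x, y}" f] assms by auto

lemma slide_stop: "right_lower_neighbours D d = {} \<Longrightarrow> slide D (T, d) = (T, d)"
  by (simp add: slide_def while_unfold)

lemma slide_move:
  assumes "right_lower_neighbours D d \<noteq> {}" "arg_min_on T (right_lower_neighbours D d) = n"
  shows "slide D (T, d) = slide D (T(d := T n), n)"
  unfolding slide_def
  by (subst while_unfold) (simp add: assms slide_step_def)

text \<open>Past the first box of the row the only possible neighbour is on the right, so no entries
  are compared. The induction is on the distance to the end, with \<open>T\<close> arbitrary because
  each move changes the filling. The last box keeps a stale entry, which promotion
  overwrites.\<close>

lemma slide_middle:
  assumes "0 < j" "j \<le> m - 3"
  shows "slide (ribbon m) (T, (1, j)) =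
    ((\<lambda>x. if fst x = 1 \<and> j \<le> snd x \<and> snd x < m - 3 then T (1, Suc (snd x)) else T x), (1, m - 3))"
  using assms
proof (induction "m - 3 - j" arbitrary: j T)
  case 0
  then have "j = m - 3" by simp
  with 0 show ?case
    by (subst slide_stop) (auto simp: neighbours_middle[unfolded One_nat_def])
next
  case (Suc n)
  then have j: "j < m - 3" by simp
  have "slide (ribbon m) (T, (1, j)) = slide (ribbon m) (T((1, j) := T (1, Suc j)), (1, Suc j))"
    by (rule slide_move)
      (use Suc.prems j in \<open>simp_all only: neighbours_middle if_True arg_min_on_singleton
        insert_not_empty not_False_eq_True\<close>)
  also have "\<dots> = ((\<lambda>x. if fst x = 1 \<and> j \<le> snd x \<and> snd x < m - 3
      then T (1, Suc (snd x)) else T x), (1, m - 3))"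
    using Suc.hyps(2) j by (subst Suc.hyps(1)) (auto simp: fun_eq_iff)
  finally show ?case .
qed

lemma promotion_ribbon_tableau:
  assumes m: "m > 3" and ac: "(a, c) \<in> end_pairs m"
  shows "promotion (ribbon m) (ribbon_tableau m (a, c)) = ribbon_tableau m (pair_promotion m (a, c))"
proof -
  let ?T = "ribbon_tableau m (a, c)"
  have ac': "1 \<le> a" "a < m" "2 \<le> c" "c \<le> m" "a \<noteq> c"
    "\<not> (a = m - 1 \<and> c = m)" "\<not> (a = 1 \<and> c = 2)"
    using ac by (simp_all add: end_pairs_def)
  have inj: "inj_on ?T (ribbon m)"
    using ribbon_tableau_in_SYT_R[OF m ac] by (auto simp: SYT_R_def SYT_def bij_betw_def)
  have start: "the_inv_into (ribbon m) ?T 1 = d" if "d \<in> ribbon m" "?T d = 1" for d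
    using the_inv_into_f_eq[OF inj that(2,1)] .
  \<comment> \<open>Reduces each case to three facts: where the \<open>1\<close> sits, where the
    slide ends, and agreement on the cells of the ribbon.\<close>
  have promotionI: "promotion (ribbon m) ?T = ribbon_tableau m y"
    if "d \<in> ribbon m" "?T d = 1" "slide (ribbon m) (?T, d) = (T', d')"
      and entries: "\<And>x. x \<in> ribbon m \<Longrightarrow> (if x = d' then m else T' x - 1) = ribbon_tableau m y x"
    for d T' d' y
  proof (rule extensionalityI)
    show "promotion (ribbon m) ?T \<in> extensional (ribbon m)"
      by (simp add: promotion_def split: prod.split)
    show "ribbon_tableau m y \<in> extensional (ribbon m)"
      by (simp add: ribbon_tableau_def split: prod.split)
    show "promotion (ribbon m) ?T x = ribbon_tableau m y x" if x: "x \<in> ribbon m" for x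
      unfolding promotion_def start[OF \<open>d \<in> ribbon m\<close> \<open>?T d = 1\<close>] \<open>slide _ _ = _\<close>
        entries[OF x, symmetric] card_ribbon[OF m]
      using x by simp
  qed
  have cells: "(0, m - 3) \<in> ribbon m" "(1, 0) \<in> ribbon m" "(2, 0) \<in> ribbon m"
    using m by (auto simp: mem_ribbon)
  show ?thesis
  proof (cases "a = 1")
    case True
    have "slide (ribbon m) (?T, (0, m - 3)) = (?T((0, m - 3) := ?T (1, m - 3)), (1, m - 3))"
      using m by (subst slide_move, simp_all add: neighbours_top arg_min_on_singleton del: One_nat_def)
         (subst slide_stop, simp_all add: neighbours_middle del: One_nat_def)
    then show ?thesis
    proof (rule promotionI[rotated 2])
      fix x assume "x \<in> ribbon m"
      then consider "x = (0, m - 3)" | j where "x = (1, j)" "j < m - 2" | "x = (2, 0)"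
        by (cases x) (auto simp: mem_ribbon)
      then show "(if x = (1, m - 3) then m else (?T((0, m - 3) := ?T (1, m - 3))) x - 1) =
        ribbon_tableau m (pair_promotion m (a, c)) x"
        using True ac' m
        by cases (auto simp: ribbon_tableau_def pair_promotion_def mem_ribbon mid_entry_def
            min_def max_def)
    qed (use True in \<open>auto simp: cells ribbon_tableau_top\<close>)
  next
    case a: False
    have one: "?T (1, 0) = 1"
      using a ac' m by (subst ribbon_tableau_middle) (auto simp: mid_entry_def)
    show ?thesis
    proof (cases "c = 2 \<or> (a = 2 \<and> c = 3)")
      case True
      have step: "pair_promotion m (a, c) = (a - 1, m)"
        using True a by (auto simp: pair_promotion_def)
      have "?T (2, 0) < ?T (1, 1)"
        using True a ac' m
        by (subst ribbon_tableau_middle) (auto simp: ribbon_tableau_bottom mid_entry_def)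
      then have "arg_min_on ?T {(1, 1), (2, 0)} = (2, 0)"
        by (metis arg_min_on_doubleton insert_commute)
      then have "slide (ribbon m) (?T, (1, 0)) = (?T((1, 0) := ?T (2, 0)), (2, 0))"
        using m by (subst slide_move, simp_all add: neighbours_corner del: One_nat_def)
          (subst slide_stop, simp_all add: neighbours_bottom del: One_nat_def)
      with cells(2) one show ?thesis
      proof (rule promotionI)
        fix x assume "x \<in> ribbon m"
        then consider "x = (0, m - 3)" | j where "x = (1, j)" "j < m - 2" | "x = (2, 0)"
          by (cases x) (auto simp: mem_ribbon)
        then show "(if x = (2, 0) then m else (?T((1, 0) := ?T (2, 0))) x - 1) =
          ribbon_tableau m (pair_promotion m (a, c)) x"
        proof cases
          case (2 j)
          \<comment> \<open>The old bottom entry moves up into the first middle box. Decremented, it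
            is 1 for \<open>c = 2\<close>, and 2 for \<open>(2, 3)\<close>, where the new top entry
            is 1.\<close>
          have "c - 1 = mid_entry (a - 1) m 0"
            using True a ac' m by (auto simp: mid_entry_def min_def max_def)
          moreover have "mid_entry a c j - 1 = mid_entry (a - 1) m j" if "j \<noteq> 0"
            using True a ac' that \<open>j < m - 2\<close>
            by (elim disjE) (simp_all add: mid_entry_def min_def max_def, arith)
          ultimately show ?thesis
            using 2 m by (cases "j = 0") (simp_all add: ribbon_tableau_def mem_ribbon step)
        qed (simp_all add: ribbon_tableau_def mem_ribbon step)
      qed
    next
      case False
      have step: "pair_promotion m (a, c) = (a - 1, c - 1)"
        using False a by (auto simp: pair_promotion_def)
      have "?T (1, 1) < ?T (2, 0)"
        using False a ac' m
        by (subst ribbon_tableau_middle) (auto simp: ribbon_tableau_bottom mid_entry_def)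
      then have "arg_min_on ?T {(1, 1), (2, 0)} = (1, 1)"
        by (rule arg_min_on_doubleton)
      then have "slide (ribbon m) (?T, (1, 0)) = slide (ribbon m) (?T((1, 0) := ?T (1, 1)), (1, 1))"
        using m by (subst slide_move, simp_all add: neighbours_corner del: One_nat_def)
      also have "\<dots> = ((\<lambda>x. if fst x = 1 \<and> snd x < m - 3
          then ?T (1, Suc (snd x)) else ?T x), (1, m - 3))"
        using m by (subst slide_middle) (auto simp: fun_eq_iff)
      finally show ?thesis
      proof (rule promotionI[OF cells(2) one])
        fix x assume "x \<in> ribbon m"
        then consider "x = (0, m - 3)" | j where "x = (1, j)" "j < m - 2" | "x = (2, 0)"
          by (cases x) (auto simp: mem_ribbon)
        then show "(if x = (1, m - 3) then m else
            (if fst x = 1 \<and> snd x < m - 3 then ?T (1, Suc (snd x)) else ?T x) - 1) =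
          ribbon_tableau m (pair_promotion m (a, c)) x"
        proof cases
          case (2 j)
          \<comment> \<open>The shift to the left and the decrement together amount to lowering both
            end entries by one.\<close>
          have "mid_entry a c (Suc j) - 1 = mid_entry (a - 1) (c - 1) j"
            using ac' mid_entry_Suc[of "a - 1" "c - 1" j] by simp
          \<comment> \<open>Both new end entries are below \<open>m\<close>, so the inserted
            \<open>m\<close> is the last middle entry.\<close>
          moreover have "mid_entry (a - 1) (c - 1) (m - 3) = m"
            using ac' m by (auto simp: mid_entry_def)
          ultimately show ?thesis
            using 2 m by (cases "j = m - 3") (simp_all add: ribbon_tableau_def mem_ribbon step, arith)
        qed (simp_all add: ribbon_tableau_def mem_ribbon step)
      qed
    qed
  qed
qed

section \<open>Cycle structure of promotion on end pairs\<close>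

text \<open>Orbit \<open>0\<close> is the exceptional cycle; on orbit \<open>k > 0\<close> one has \<open>c - a \<equiv> k + 1\<close> modulo \<open>m - 1\<close>.\<close>

definition orbit_length :: "nat \<Rightarrow> nat \<Rightarrow> nat" where
  "orbit_length m k = (if k = 0 then m - 2 else m - 1)"

text \<open>Here \<open>r\<close> counts promotions from a base pair, which is \<open>(1, m)\<close>
  for \<open>k = 0\<close> and \<open>(m - 1, k + 1)\<close> otherwise. For \<open>k > 0\<close> the
  second coordinate is 2 at \<open>r = k - 1\<close> and wraps round to \<open>m\<close> at
  \<open>r = k\<close>.\<close>

definition orbit_pair :: "nat \<Rightarrow> nat \<Rightarrow> nat \<Rightarrow> nat \<times> nat" where
  "orbit_pair m k r =
     (if k = 0 then (if r = 0 then (1, m) else (m - 1 - r, m - r))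
      else (m - 1 - r, if k \<le> r then m + k - r else k + 1 - r))"

lemma orbit_pair_in_end_pairs:
  assumes "m > 3" "k < m - 2" "r < orbit_length m k"
  shows "orbit_pair m k r \<in> end_pairs m"
  using assms by (auto simp: orbit_pair_def end_pairs_def orbit_length_def split: if_splits)

text \<open>Equal first coordinates determine \<open>r'\<close>. For \<open>r = 0\<close> this gives
  \<open>r' = m - 2\<close>, with second coordinate \<open>k + 2 < m\<close>. Otherwise
  \<open>r' = r\<close>, and equal second coordinates would force \<open>k = 0\<close> or
  \<open>k = m - 1\<close>.\<close>

lemma orbit_pair_0_neq:
  assumes "0 < k" "k < m - 2" "r < m - 2" "r' < m - 1"
  shows "orbit_pair m 0 r \<noteq> orbit_pair m k r'"
proof
  assume eq: "orbit_pair m 0 r = orbit_pair m k r'"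
  show False
  proof (cases "r = 0")
    case True
    then have "r' = m - 2"
      using eq assms by (auto simp: orbit_pair_def)
    then show False
      using eq assms True by (simp add: orbit_pair_def)
  next
    case False
    then have "m - 1 - r = m - 1 - r'"
      using eq assms by (simp add: orbit_pair_def)
    then have "r' = r"
      using assms by linarith
    then show False
      using eq assms False by (auto simp: orbit_pair_def split: if_splits)
  qed
qed

text \<open>On the orbits with \<open>k > 0\<close> the first coordinate recovers \<open>r\<close>,
  after which the second recovers \<open>k\<close>.\<close>

lemma orbit_pair_inject:
  assumes "k < m - 2" "r < orbit_length m k" "k' < m - 2" "r' < orbit_length m k'"
    "orbit_pair m k r = orbit_pair m k' r'"
  shows "k = k' \<and> r = r'"
proof -
  consider "k = 0" "k' = 0" | "k = 0" "k' \<noteq> 0" | "k \<noteq> 0" "k' = 0" | "k \<noteq> 0" "k' \<noteq> 0"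
    by blast
  then show ?thesis
  proof cases
    case 1
    then show ?thesis
      using assms by (cases "r = 0"; cases "r' = 0") (simp_all add: orbit_pair_def orbit_length_def, arith+)
  next
    case 2
    then show ?thesis
      using assms orbit_pair_0_neq[of k' m r r'] by (simp add: orbit_length_def)
  next
    case 3
    then show ?thesis
      using assms orbit_pair_0_neq[of k m r' r] by (simp add: orbit_length_def)
  next
    case 4
    then have "m - 1 - r = m - 1 - r'" "r < m - 1" "r' < m - 1"
      using assms by (simp_all add: orbit_pair_def orbit_length_def)
    then have "r' = r"
      by linarith
    then show ?thesis
      using 4 assms by (cases "k \<le> r"; cases "k' \<le> r") (simp_all add: orbit_pair_def orbit_length_def)
  qed
qed

lemma end_pairs_obtain_orbit:
  assumes "m > 3" "(a, c) \<in> end_pairs m"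
  obtains k r where "k < m - 2" "r < orbit_length m k" "(a, c) = orbit_pair m k r"
proof -
  have ac: "1 \<le> a" "a < m" "2 \<le> c" "c \<le> m" "a \<noteq> c"
    "\<not> (a = m - 1 \<and> c = m)" "\<not> (a = 1 \<and> c = 2)"
    using assms(2) by (simp_all add: end_pairs_def)
  \<comment> \<open>Apart from \<open>(1, m)\<close>, the first coordinate dictates
    \<open>r = m - 1 - a\<close>, and \<open>k\<close> is the residue of \<open>c - a - 1\<close>
    modulo \<open>m - 1\<close>; for \<open>c < a\<close> this adds \<open>m - 1\<close>.\<close>
  consider "a = 1" "c = m" | "c = a + 1" | "a + 1 < c" "\<not> (a = 1 \<and> c = m)" | "c < a"
    using ac by linarith
  then show ?thesis
  proof cases
    case 1
    then show ?thesis
      using assms(1) by (intro that[of 0 0]) (auto simp: orbit_length_def orbit_pair_def)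
  next
    case 2
    then show ?thesis
      using assms(1) ac
      by (intro that[of 0 "m - 1 - a"]) (auto simp: orbit_length_def orbit_pair_def)
  next
    case 3
    then show ?thesis
      using assms(1) ac
      by (intro that[of "c - a - 1" "m - 1 - a"]) (auto simp: orbit_length_def orbit_pair_def)
  next
    case 4
    then show ?thesis
      using assms(1) ac
      by (intro that[of "c + m - 2 - a" "m - 1 - a"]) (auto simp: orbit_length_def orbit_pair_def)
  qed
qed

lemma pair_promotion_orbit_pair:
  assumes "m > 3" "k < m - 2" "r < orbit_length m k"
  shows "pair_promotion m (orbit_pair m k r) =
    orbit_pair m k (if Suc r = orbit_length m k then 0 else Suc r)"
proof (cases "k = 0")
  case k: True
  \<comment> \<open>The pairs \<open>(1, m)\<close> and \<open>(2, 3)\<close>, where the exceptional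
    rules apply, and the remaining pairs \<open>(a, a + 1)\<close>.\<close>
  consider "r = 0" | "r = m - 3" "0 < r" | "0 < r" "r < m - 3"
    using assms k by (fastforce simp: orbit_length_def)
  then show ?thesis
    using assms(1)
    by cases (simp_all add: k orbit_pair_def pair_promotion_def orbit_length_def, arith+)
next
  case k: False
  show ?thesis
  \<comment> \<open>This is \<open>a = 1\<close>, where the first coordinate wraps round to
    \<open>m - 1\<close>.\<close>
  proof (cases "r = m - 2")
    case True
    then show ?thesis
      using assms k by (simp add: orbit_pair_def pair_promotion_def orbit_length_def, arith)
  next
    case r: False
    then have "r < m - 2"
      using assms k by (simp add: orbit_length_def)
    then have next_r: "(if Suc r = orbit_length m k then 0 else Suc r) = Suc r"
      using k by (simp add: orbit_length_def)
    \<comment> \<open>The case \<open>k = Suc r\<close> is \<open>c = 2\<close>, where the second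
      coordinate wraps round; in the others both coordinates drop by one.\<close>
    consider "k \<le> r" | "k = Suc r" | "Suc r < k" by linarith
    then show ?thesis
      unfolding next_r using assms(1,2) k \<open>r < m - 2\<close>
      by cases (simp_all add: orbit_pair_def pair_promotion_def, arith+)
  qed
qed

section \<open>Permutations with enumerated finite cycles\<close>

text \<open>The orbits of \<open>p\<close> are indexed by \<open>K\<close>, and \<open>e k\<close> is the periodic enumeration of orbit \<open>k\<close>
  by all integers, so that negative powers of \<open>p\<close> are translations as well.\<close>

locale cyclic_orbits =
  fixes X :: "'x set" and p :: "'x \<Rightarrow> 'x" and K :: "'k set" and len :: "'k \<Rightarrow> nat"
    and e :: "'k \<Rightarrow> int \<Rightarrow> 'x"
  assumes finite_K: "finite K"
    and len_pos: "\<And>k. k \<in> K \<Longrightarrow> 0 < len k"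
    and p_extensional: "p \<in> extensional X"
    and X_eq: "X = (\<Union>k\<in>K. range (e k))"
    and e_eq_iff: "\<And>k k' i j. k \<in> K \<Longrightarrow> k' \<in> K \<Longrightarrow>
      e k i = e k' j \<longleftrightarrow> k = k' \<and> int (len k) dvd i - j"
    and p_e: "\<And>k i. k \<in> K \<Longrightarrow> p (e k i) = e k (i + 1)"
begin

abbreviation "B \<equiv> BijGroup X"

sublocale B: group B
  by (rule group_BijGroup)

lemma mem_X_iff: "x \<in> X \<longleftrightarrow> (\<exists>k\<in>K. \<exists>i. x = e k i)"
  by (auto simp: X_eq)

lemma e_in_X: "k \<in> K \<Longrightarrow> e k i \<in> X"
  by (auto simp: mem_X_iff)

lemma p_closed: "p \<in> carrier B"
proof -
  have "inj_on p X"
    by (rule inj_onI) (auto simp: X_eq p_e e_eq_iff)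
  moreover have "p ` X = X"
  proof
    show "p ` X \<subseteq> X" by (auto simp: X_eq p_e)
    show "X \<subseteq> p ` X"
    proof
      fix x assume "x \<in> X"
      then obtain k i where "k \<in> K" "x = e k i" by (auto simp: X_eq)
      then show "x \<in> p ` X"
        using p_e[of k "i - 1"] e_in_X[of k "i - 1"] by (metis diff_add_cancel image_eqI)
    qed
  qed
  ultimately show ?thesis
    by (simp add: BijGroup_def Bij_def p_extensional bij_betw_def)
qed

lemma mult_apply:
  "f \<in> carrier B \<Longrightarrow> g \<in> carrier B \<Longrightarrow> x \<in> X \<Longrightarrow> (f \<otimes>\<^bsub>B\<^esub> g) x = f (g x)"
  by (simp add: BijGroup_def compose_eq)

lemma one_apply: "x \<in> X \<Longrightarrow> \<one>\<^bsub>B\<^esub> x = x"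
  by (simp add: BijGroup_def)

lemma nat_pow_e: "k \<in> K \<Longrightarrow> (p [^]\<^bsub>B\<^esub> (n::nat)) (e k i) = e k (i + int n)"
proof (induction n arbitrary: i)
  case 0
  then show ?case by (simp add: one_apply e_in_X)
next
  case (Suc n)
  then show ?case
    by (simp add: mult_apply p_closed e_in_X p_e algebra_simps)
qed

lemma int_pow_e:
  assumes "k \<in> K"
  shows "(p [^]\<^bsub>B\<^esub> (n::int)) (e k i) = e k (i + n)"
proof (cases n rule: int_cases2)
  case (nonneg l)
  then show ?thesis by (simp add: int_pow_int nat_pow_e assms)
next
  case (nonpos l)
  let ?q = "p [^]\<^bsub>B\<^esub> l"
  have q: "?q \<in> carrier B" by (simp add: p_closed)
  \<comment> \<open>Since \<open>n = - int l\<close>, the power \<open>?q\<close> carries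
    \<open>e k (i + n)\<close> to \<open>e k i\<close>, and its inverse undoes this.\<close>
  have "(inv\<^bsub>B\<^esub> ?q) (e k i) = (inv\<^bsub>B\<^esub> ?q) (?q (e k (i + n)))"
    using assms nonpos by (simp add: nat_pow_e)
  also have "\<dots> = (inv\<^bsub>B\<^esub> ?q \<otimes>\<^bsub>B\<^esub> ?q) (e k (i + n))"
    using q assms by (subst mult_apply) (simp_all add: e_in_X)
  also have "\<dots> = e k (i + n)"
    using q assms by (simp add: one_apply e_in_X)
  finally show ?thesis
    using nonpos by (simp add: B.int_pow_neg_int p_closed)
qed

lemma fixed_iff:
  assumes "k \<in> K"
  shows "(p [^]\<^bsub>B\<^esub> (n::int)) (e k i) = e k i \<longleftrightarrow> int (len k) dvd n"
  using assms by (simp add: int_pow_e e_eq_iff)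

lemma range_e_eq_image:
  assumes "k \<in> K"
  shows "range (e k) = e k ` {0..<int (len k)}"
proof
  show "range (e k) \<subseteq> e k ` {0..<int (len k)}"
  proof
    fix x assume "x \<in> range (e k)"
    then obtain i where "x = e k i" by blast
    moreover have "e k i = e k (i mod int (len k))"
      using assms by (simp add: e_eq_iff minus_mod_eq_mult_div)
    moreover have "i mod int (len k) \<in> {0..<int (len k)}"
      using len_pos[OF assms] by simp
    ultimately show "x \<in> e k ` {0..<int (len k)}" by blast
  qed
qed auto

lemma finite_range_e: "k \<in> K \<Longrightarrow> finite (range (e k))"
  by (simp add: range_e_eq_image)

lemma card_range_e:
  assumes "k \<in> K"
  shows "card (range (e k)) = len k"
proof -
  have "inj_on (e k) {0..<int (len k)}"
  proof (rule inj_onI)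
    fix i j assume ij: "i \<in> {0..<int (len k)}" "j \<in> {0..<int (len k)}" "e k i = e k j"
    then have "i mod int (len k) = j mod int (len k)"
      using assms by (simp only: e_eq_iff mod_eq_dvd_iff)
    then show "i = j"
      using ij by (metis atLeastLessThan_iff mod_pos_pos_trivial)
  qed
  then show ?thesis
    using assms by (simp add: range_e_eq_image card_image)
qed

lemma finite_X: "finite X"
  unfolding X_eq using finite_K finite_range_e by blast

lemma range_e_disjoint: "k \<in> K \<Longrightarrow> k' \<in> K \<Longrightarrow> k \<noteq> k' \<Longrightarrow> range (e k) \<inter> range (e k') = {}"
  by (auto simp: e_eq_iff)

text \<open>The generated group consists of the integer powers of \<open>p\<close>, which act as all
  translations of the index.\<close>

lemma orbits_eq: "orbits (subgroup_generated B {p}) X (\<lambda>g. g) = (\<lambda>k. range (e k)) ` K"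
proof -
  have "orbit (subgroup_generated B {p}) (\<lambda>g. g) (e k i) = range (e k)" if "k \<in> K" for k i
  proof -
    have "orbit (subgroup_generated B {p}) (\<lambda>g. g) (e k i) =
        (\<lambda>g. g (e k i)) ` range (\<lambda>n::int. p [^]\<^bsub>B\<^esub> n)"
      unfolding orbit_def B.carrier_subgroup_generated_by_singleton[OF p_closed] by blast
    also have "\<dots> = range (\<lambda>n. e k (i + n))"
      using that by (simp add: image_image int_pow_e)
    also have "\<dots> = range (e k)"
      by (metis image_image surj_plus)
    finally show ?thesis .
  qed
  then show ?thesis
    by (auto simp: orbits_def X_eq) blast+
qed

lemma card_orbits_of_size:
  "card {Q \<in> orbits (subgroup_generated B {p}) X (\<lambda>g. g). card Q = l} = card {k \<in> K. len k = l}"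
proof -
  have "{Q \<in> orbits (subgroup_generated B {p}) X (\<lambda>g. g). card Q = l} =
      (\<lambda>k. range (e k)) ` {k \<in> K. len k = l}"
    by (auto simp: orbits_eq card_range_e)
  moreover have "inj_on (\<lambda>k. range (e k)) {k \<in> K. len k = l}"
    by (rule inj_onI) (use range_e_disjoint in blast)
  ultimately show ?thesis
    by (simp add: card_image)
qed

text \<open>A power of \<open>p\<close> translates every index by the same amount, so it fixes an
  orbit pointwise or moves all of its points.\<close>

lemma card_fixed:
  "card {x \<in> X. (p [^]\<^bsub>B\<^esub> (n::int)) x = x} = (\<Sum>k\<in>K. if int (len k) dvd n then len k else 0)"
proof -
  have "{x \<in> X. (p [^]\<^bsub>B\<^esub> n) x = x} = (\<Union>k\<in>{k \<in> K. int (len k) dvd n}. range (e k))"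
    by (auto simp: mem_X_iff fixed_iff)
  also have "card \<dots> = (\<Sum>k\<in>{k \<in> K. int (len k) dvd n}. card (range (e k)))"
    by (rule card_UN_disjoint) (auto simp: finite_K finite_range_e range_e_disjoint)
  also have "\<dots> = (\<Sum>k\<in>{k \<in> K. int (len k) dvd n}. len k)"
    by (simp add: card_range_e)
  also have "\<dots> = (\<Sum>k\<in>K. if int (len k) dvd n then len k else 0)"
    by (simp add: finite_K sum.inter_filter)
  finally show ?thesis .
qed

text \<open>Group elements are extensional on \<open>X\<close>, so equality with the identity can be
  tested on the enumerated points.\<close>

lemma int_pow_eq_one_iff: "p [^]\<^bsub>B\<^esub> (n::int) = \<one>\<^bsub>B\<^esub> \<longleftrightarrow> (\<forall>k\<in>K. int (len k) dvd n)"
proof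
  assume "p [^]\<^bsub>B\<^esub> n = \<one>\<^bsub>B\<^esub>"
  then show "\<forall>k\<in>K. int (len k) dvd n"
    by (metis e_in_X fixed_iff one_apply)
next
  assume dvd: "\<forall>k\<in>K. int (len k) dvd n"
  have "p [^]\<^bsub>B\<^esub> n \<in> extensional X"
  proof -
    have "carrier B \<subseteq> extensional X"
      by (auto simp: BijGroup_def Bij_def)
    then show ?thesis
      using B.int_pow_closed[OF p_closed] by blast
  qed
  moreover have "\<one>\<^bsub>B\<^esub> \<in> extensional X"
    by (simp add: BijGroup_def)
  moreover have "(p [^]\<^bsub>B\<^esub> n) x = \<one>\<^bsub>B\<^esub> x" if "x \<in> X" for x
    using that dvd by (auto simp: one_apply mem_X_iff fixed_iff e_in_X)
  ultimately show "p [^]\<^bsub>B\<^esub> n = \<one>\<^bsub>B\<^esub>"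
    by (rule extensionalityI)
qed

end

section \<open>Evaluation of the sieving polynomial at roots of unity\<close>

lemma coeff_q_int: "coeff (q_int r :: 'a::comm_ring_1 poly) i = (if i < r then 1 else 0)"
proof -
  have "(\<Sum>j<r. coeff ([:0, 1:] ^ j :: 'a poly) i) = (\<Sum>j<r. if i = j then 1 else 0)"
    by (rule sum.cong) (auto simp flip: monom_altdef[of 1, simplified])
  then show ?thesis
    by (simp add: q_int_def coeff_sum)
qed

lemma poly_q_int: "poly (q_int r) x = (\<Sum>i<r. x ^ i)"
  by (simp add: q_int_def poly_sum poly_power)

lemma eval2_psi:
  "eval2 (psi m) q t = (\<Sum>i<m - 2. t ^ i) + of_nat (m - 3) * (\<Sum>i<m - 1. q ^ i)"
proof -
  \<comment> \<open>Evaluation of the inner variable. The coefficients of \<open>psi m\<close> in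
    \<open>q\<close> are built additively from naturals and one \<open>q_int\<close>, so additivity
    and these values of \<open>h\<close> suffice.\<close>
  define h where "h = (\<lambda>p :: int poly. poly (map_poly of_int p) t)"
  have h_add: "h (a + b) = h a + h b" for a b
  proof -
    have "map_poly of_int (a + b) = map_poly of_int a + (map_poly of_int b :: complex poly)"
      by (rule poly_eqI) (simp add: coeff_map_poly)
    then show ?thesis by (simp add: h_def)
  qed
  have h_0: "h 0 = 0" by (simp add: h_def)
  have h_of_nat: "h (of_nat n) = of_nat n" for n
    by (simp add: h_def of_nat_poly map_poly_pCons)
  have "map_poly of_int (q_int r) = (q_int r :: complex poly)" for r
    by (rule poly_eqI) (simp add: coeff_map_poly coeff_q_int)
  then have h_q_int: "h (q_int r) = (\<Sum>i<r. t ^ i)" for r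
    by (simp add: h_def poly_q_int)
  have "map_poly h (psi m) = [:\<Sum>i<m - 2. t ^ i:] + of_nat (m - 3) * q_int (m - 1)"
    by (rule poly_eqI)
      (simp add: coeff_map_poly h_0 h_add psi_def of_nat_poly coeff_q_int coeff_pCons
        h_q_int h_of_nat[unfolded of_nat_poly] split: nat.split)
  then show ?thesis
    by (simp add: eval2_def h_def poly_q_int)
qed

lemma primitive_root_powi_eq_1_iff:
  assumes "primitive_root_of_unity k z"
  shows "z powi s = 1 \<longleftrightarrow> int k dvd s"
proof -
  have k: "0 < k" and zk: "z ^ k = 1" and prim: "\<And>j. 0 < j \<Longrightarrow> j < k \<Longrightarrow> z ^ j \<noteq> 1"
    using assms by (auto simp: primitive_root_of_unity_def)
  have "z \<noteq> 0" using k zk by (auto simp: power_0_left)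
  define j where "j = nat (s mod int k)"
  have j: "int j = s mod int k" "j < k"
    using k by (auto simp: j_def nat_less_iff)
  have "z powi s = z powi (int k * (s div int k) + int j)"
    using j by simp
  also have "\<dots> = z powi (int k * (s div int k)) * z powi (int j)"
    using \<open>z \<noteq> 0\<close> by (intro power_int_add) auto
  also have "\<dots> = z ^ j"
    using zk by (simp add: power_int_mult)
  finally have "z powi s = z ^ j" .
  moreover have "z ^ j = 1 \<longleftrightarrow> j = 0"
    using prim j(2) by (cases "j = 0") auto
  ultimately show ?thesis
    by (simp add: dvd_eq_mod_eq_0 flip: j(1))
qed

text \<open>The ratio is a \<open>k\<close>-th root of unity, so the geometric sum vanishes unless
  the ratio is 1.\<close>

lemma sum_powers_primitive_root:
  assumes "primitive_root_of_unity k z"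
  shows "(\<Sum>i<k. (z powi s) ^ i) = (if int k dvd s then of_nat k else 0)"
proof (cases "int k dvd s")
  case True
  then show ?thesis
    using primitive_root_powi_eq_1_iff[OF assms, of s] by simp
next
  case False
  have "(z powi s) ^ k = (z ^ k) powi s"
    by (metis mult.commute power_int_mult power_int_of_nat)
  also have "\<dots> = 1"
    using assms by (simp add: primitive_root_of_unity_def)
  finally show ?thesis
    using False primitive_root_powi_eq_1_iff[OF assms, of s] by (simp add: geometric_sum)
qed

section \<open>Orbits on tableaux and the sieving identity\<close>

definition orbit_tableau :: "nat \<Rightarrow> nat \<Rightarrow> int \<Rightarrow> tableau" where
  "orbit_tableau m k i = ribbon_tableau m (orbit_pair m k (nat (i mod int (orbit_length m k))))"

text \<open>The cycle structure of end pairs is carried over by the injective map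
  \<open>ribbon_tableau\<close>; reducing indices modulo the orbit length turns cycle positions into
  a periodic enumeration.\<close>

lemma cyclic_orbits_ribbon_promotion:
  assumes m: "m > 3"
  shows "cyclic_orbits (SYT_R m) (ribbon_promotion m) {..<m - 2} (orbit_length m) (orbit_tableau m)"
proof
  have pos: "0 < orbit_length m k" for k
    using m by (simp add: orbit_length_def)
  then show "0 < orbit_length m k" for k .
  have residue: "nat (i mod int (orbit_length m k)) < orbit_length m k" for i k
    using pos[of k] by (simp add: nat_less_iff)
  have closed: "orbit_tableau m k i \<in> SYT_R m" if "k < m - 2" for k i
    unfolding orbit_tableau_def
    using ribbon_tableau_in_SYT_R[OF m] orbit_pair_in_end_pairs[OF m that residue[of i k]]
    by (metis prod.collapse)
  show "SYT_R m = (\<Union>k\<in>{..<m - 2}. range (orbit_tableau m k))"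
  proof
    show "SYT_R m \<subseteq> (\<Union>k\<in>{..<m - 2}. range (orbit_tableau m k))"
    proof
      fix T assume "T \<in> SYT_R m"
      then obtain a c where "(a, c) \<in> end_pairs m" "T = ribbon_tableau m (a, c)"
        using SYT_R_obtain_pair[OF m] by (metis prod.collapse)
      then obtain k r where "k < m - 2" "r < orbit_length m k" "T = ribbon_tableau m (orbit_pair m k r)"
        using end_pairs_obtain_orbit[OF m] by metis
      moreover from this have "T = orbit_tableau m k (int r)"
        by (simp add: orbit_tableau_def)
      ultimately show "T \<in> (\<Union>k\<in>{..<m - 2}. range (orbit_tableau m k))"
        by blast
    qed
  qed (auto simp: closed)
  show "ribbon_promotion m \<in> extensional (SYT_R m)"
    by (simp add: ribbon_promotion_def)
  show "orbit_tableau m k i = orbit_tableau m k' j \<longleftrightarrow>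
      k = k' \<and> int (orbit_length m k) dvd i - j"
    if "k \<in> {..<m - 2}" "k' \<in> {..<m - 2}" for k k' i j
  proof -
    have "orbit_tableau m k i = orbit_tableau m k' j \<longleftrightarrow>
        k = k' \<and> nat (i mod int (orbit_length m k)) = nat (j mod int (orbit_length m k'))"
      using orbit_pair_inject[of k m _ k'] that residue
      by (auto simp: orbit_tableau_def inj_eq[OF inj_ribbon_tableau])
    also have "\<dots> \<longleftrightarrow> k = k' \<and> i mod int (orbit_length m k) = j mod int (orbit_length m k)"
      using pos[of k] by (auto simp: nat_eq_iff)
    also have "\<dots> \<longleftrightarrow> k = k' \<and> int (orbit_length m k) dvd i - j"
      by (simp add: mod_eq_dvd_iff)
    finally show ?thesis .
  qed
  show "ribbon_promotion m (orbit_tableau m k i) = orbit_tableau m k (i + 1)"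
    if "k \<in> {..<m - 2}" for k i
  proof -
    define L r where "L = orbit_length m k" and "r = nat (i mod int L)"
    have r: "int r = i mod int L" "r < L"
      using pos[of k] residue[of i k] by (simp_all add: L_def r_def)
    have "(i + 1) mod int L = (int r + 1) mod int L"
      by (simp add: r(1) mod_add_left_eq)
    also have "\<dots> = int (if Suc r = L then 0 else Suc r)"
      using r(2) by (auto simp: add.commute)
    finally have next_r: "nat ((i + 1) mod int L) = (if Suc r = L then 0 else Suc r)"
      by simp
    have "ribbon_promotion m (orbit_tableau m k i) =
        promotion (ribbon m) (ribbon_tableau m (orbit_pair m k r))"
      using closed[of k i] that by (simp add: ribbon_promotion_def orbit_tableau_def r_def L_def)
    also have "\<dots> = ribbon_tableau m (pair_promotion m (orbit_pair m k r))"
      using promotion_ribbon_tableau[OF m] orbit_pair_in_end_pairs[OF m] that r(2)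
      by (metis L_def lessThan_iff prod.collapse)
    also have "\<dots> = orbit_tableau m k (i + 1)"
      using pair_promotion_orbit_pair[OF m, of k r] that r(2) next_r
      by (simp add: orbit_tableau_def L_def)
    finally show ?thesis .
  qed
qed simp

lemma card_fixed_tableaux:
  assumes m: "m > 3"
  shows "card {T \<in> SYT_R m. (ribbon_promotion m [^]\<^bsub>BijGroup (SYT_R m)\<^esub>
      (r * (int m - 2) + s * (int m - 1))) T = T} =
    (if int (m - 2) dvd s then m - 2 else 0) +
    (m - 3) * (if int (m - 1) dvd r then m - 1 else 0)"
proof -
  interpret cyclic_orbits "SYT_R m" "ribbon_promotion m" "{..<m - 2}" "orbit_length m"
    "orbit_tableau m"
    by (rule cyclic_orbits_ribbon_promotion[OF m])
  define n where "n = r * (int m - 2) + s * (int m - 1)"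
  \<comment> \<open>Thus \<open>n\<close> is congruent to \<open>s\<close> modulo
    \<open>m - 2\<close> and to \<open>-r\<close> modulo \<open>m - 1\<close>, which separates the
    two exponents.\<close>
  have "n = s + int (m - 2) * (r + s)" "n = int (m - 1) * (r + s) - r"
    using m by (simp_all add: n_def of_nat_diff algebra_simps)
  then have dvd: "int (m - 2) dvd n \<longleftrightarrow> int (m - 2) dvd s" "int (m - 1) dvd n \<longleftrightarrow> int (m - 1) dvd r"
    by (metis dvd_add_left_iff dvd_triv_left, metis dvd_diff_right_iff dvd_triv_left)
  let ?f = "\<lambda>k. if int (orbit_length m k) dvd n then orbit_length m k else 0"
  have "{..<m - 2} = insert 0 {1..<m - 2}"
    using m by auto
  then have "sum ?f {..<m - 2} = ?f 0 + sum ?f {1..<m - 2}"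
    by simp
  also have "?f 0 = (if int (m - 2) dvd s then m - 2 else 0)"
    by (simp only: orbit_length_def dvd simp_thms if_True)
  also have "sum ?f {1..<m - 2} = (\<Sum>k\<in>{1..<m - 2}. if int (m - 1) dvd r then m - 1 else 0)"
  proof (rule sum.cong)
    fix k assume "k \<in> {1..<m - 2}"
    then have "orbit_length m k = m - 1"
      by (simp add: orbit_length_def)
    then show "?f k = (if int (m - 1) dvd r then m - 1 else 0)"
      by (simp only: dvd)
  qed simp
  also have "\<dots> = (m - 3) * (if int (m - 1) dvd r then m - 1 else 0)"
    by simp
  finally show ?thesis
    by (simp only: card_fixed flip: n_def)
qed

lemma eval2_psi_eq_card_fixed:
  assumes "m > 3" "primitive_root_of_unity (m - 1) \<xi>" "primitive_root_of_unity (m - 2) \<zeta>"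
  shows "eval2 (psi m) (\<xi> powi r) (\<zeta> powi s) =
    of_nat (card {T \<in> SYT_R m. (ribbon_promotion m [^]\<^bsub>BijGroup (SYT_R m)\<^esub>
      (r * (int m - 2) + s * (int m - 1))) T = T})"
  unfolding eval2_psi card_fixed_tableaux[OF assms(1)]
    sum_powers_primitive_root[OF assms(2)] sum_powers_primitive_root[OF assms(3)]
  by simp

theorem mainTheorem17:
  fixes m :: nat and \<xi> \<zeta> :: complex
  assumes "m > 3"
    and "primitive_root_of_unity (m - 1) \<xi>"
    and "primitive_root_of_unity (m - 2) \<zeta>"
  shows
    "let X = SYT_R m; B = BijGroup X; p = ribbon_promotion m;
         Orb = orbits (subgroup_generated B {p}) X (\<lambda>g. g)
     in p \<in> carrier B \<and>
        group.ord B p = (m - 1) * (m - 2) \<and>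
        card {Q \<in> Orb. card Q = m - 2} = 1 \<and>
        card {Q \<in> Orb. card Q = m - 1} = m - 3 \<and>
        (\<forall>Q \<in> Orb. card Q = m - 2 \<or> card Q = m - 1) \<and>
        (\<forall>r s :: int.
           eval2 (psi m) (\<xi> powi r) (\<zeta> powi s) =
           of_nat (card {T \<in> X. (p [^]\<^bsub>B\<^esub> (r * (int m - 2) + s * (int m - 1))) T = T})) \<and>
        bicyclic_sieving
          (subgroup_generated B {p [^]\<^bsub>B\<^esub> (m - 2)}) (p [^]\<^bsub>B\<^esub> (m - 2))
          (subgroup_generated B {p [^]\<^bsub>B\<^esub> (m - 1)}) (p [^]\<^bsub>B\<^esub> (m - 1))
          X (\<lambda>(g, h). g \<otimes>\<^bsub>B\<^esub> h) (psi m)"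
proof -
  note m = assms(1)
  interpret cyclic_orbits "SYT_R m" "ribbon_promotion m" "{..<m - 2}" "orbit_length m"
    "orbit_tableau m"
    by (rule cyclic_orbits_ribbon_promotion[OF m])
  let ?X = "SYT_R m" and ?p = "ribbon_promotion m"
  let ?Orb = "orbits (subgroup_generated B {?p}) ?X (\<lambda>g. g)"
  let ?c = "?p [^]\<^bsub>B\<^esub> (m - 2)" and ?d = "?p [^]\<^bsub>B\<^esub> (m - 1)"
  let ?G = "subgroup_generated B {?c}" and ?H = "subgroup_generated B {?d}"
  have pow_eq_one: "?p [^]\<^bsub>B\<^esub> n = \<one>\<^bsub>B\<^esub> \<longleftrightarrow> (m - 1) * (m - 2) dvd n" for n :: nat
  proof -
    have "?p [^]\<^bsub>B\<^esub> n = \<one>\<^bsub>B\<^esub> \<longleftrightarrow> (\<forall>k<m - 2. orbit_length m k dvd n)"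
      using int_pow_eq_one_iff[of "int n"] by (simp add: int_pow_int Ball_def)
    also have "\<dots> \<longleftrightarrow> m - 1 dvd n \<and> m - 2 dvd n"
    proof -
      \<comment> \<open>Index 1 is available because \<open>m > 3\<close>, so both lengths really
        occur.\<close>
      have "orbit_length m 0 = m - 2" "orbit_length m 1 = m - 1"
        by (simp_all add: orbit_length_def)
      moreover have "0 < m - 2" "1 < m - 2"
        using m by simp_all
      ultimately show ?thesis
        by (metis orbit_length_def)
    qed
    also have "\<dots> \<longleftrightarrow> (m - 1) * (m - 2) dvd n"
    proof -
      \<comment> \<open>Consecutive numbers are coprime, so being divisible by both means being
        divisible by their product.\<close>
      have "m - 1 = Suc (m - 2)" using m by simp
      then have "coprime (m - 1) (m - 2)"
        by (metis coprime_Suc_left_nat)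
      then show ?thesis
        by (metis divides_mult dvd_mult_left dvd_mult_right)
    qed
    finally show ?thesis .
  qed
  have ord_p: "B.ord ?p = (m - 1) * (m - 2)"
    by (simp add: B.ord_unique p_closed pow_eq_one)
  have c: "?c \<in> carrier B" and d: "?d \<in> carrier B"
    by (simp_all add: p_closed)
  have "B.ord ?c = m - 1"
    unfolding B.ord_unique[OF c] B.nat_pow_pow[OF p_closed] pow_eq_one
    using m by (simp add: mult.commute[of "m - 1"])
  then have order_G: "Coset.order ?G = m - 1"
    using B.cyclic_order_is_ord[OF c] by simp
  have "B.ord ?d = m - 2"
    unfolding B.ord_unique[OF d] B.nat_pow_pow[OF p_closed] pow_eq_one
    using m by simp
  then have order_H: "Coset.order ?H = m - 2"
    using B.cyclic_order_is_ord[OF d] by simp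
  have c_G: "?c \<in> carrier ?G" and d_H: "?d \<in> carrier ?H"
    using B.subgroup_generated_subset_carrier_subset c d by blast+
  have action: "group_action (?G \<times>\<times> ?H) ?X (\<lambda>(g, h). g \<otimes>\<^bsub>B\<^esub> h)"
  proof -
    \<comment> \<open>All elements involved are powers of the single element \<open>?p\<close>,
      hence commute; this makes the product map a homomorphism.\<close>
    have powers: "\<exists>i::int. g = ?p [^]\<^bsub>B\<^esub> i"
      if "g \<in> carrier (subgroup_generated B {?p [^]\<^bsub>B\<^esub> l})" for g and l :: nat
      using that
      by (auto simp: B.carrier_subgroup_generated_by_singleton p_closed B.int_pow_pow
          simp flip: int_pow_int)
    have "(\<lambda>(g, h). g \<otimes>\<^bsub>B\<^esub> h) \<in> hom (?G \<times>\<times> ?H) B"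
    proof (rule homI)
      fix x assume "x \<in> carrier (?G \<times>\<times> ?H)"
      then show "(case x of (g, h) \<Rightarrow> g \<otimes>\<^bsub>B\<^esub> h) \<in> carrier B"
        using B.carrier_subgroup_generated_subset by (auto simp: DirProd_def)
    next
      fix x y assume "x \<in> carrier (?G \<times>\<times> ?H)" "y \<in> carrier (?G \<times>\<times> ?H)"
      then obtain i j i' j' :: int where "x = (?p [^]\<^bsub>B\<^esub> i, ?p [^]\<^bsub>B\<^esub> j)" "y = (?p [^]\<^bsub>B\<^esub> i', ?p [^]\<^bsub>B\<^esub> j')"
        using powers by (auto simp: DirProd_def) metis
      then show "(case x \<otimes>\<^bsub>?G \<times>\<times> ?H\<^esub> y of (g, h) \<Rightarrow> g \<otimes>\<^bsub>B\<^esub> h) =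
          (case x of (g, h) \<Rightarrow> g \<otimes>\<^bsub>B\<^esub> h) \<otimes>\<^bsub>B\<^esub> (case y of (g, h) \<Rightarrow> g \<otimes>\<^bsub>B\<^esub> h)"
        by (simp add: DirProd_def p_closed add_ac flip: B.int_pow_mult)
    qed
    then show ?thesis
      by (simp add: group_action_def group_hom_def group_hom_axioms_def DirProd_group B.group_axioms)
  qed
  \<comment> \<open>The variable \<open>q\<close> belongs to \<open>?c\<close>, of order
    \<open>m - 1\<close>, whose exponent is therefore weighted by \<open>m - 2\<close>; dually for
    \<open>t\<close> and \<open>?d\<close>.\<close>
  have pow_mult: "?c [^]\<^bsub>B\<^esub> i \<otimes>\<^bsub>B\<^esub> ?d [^]\<^bsub>B\<^esub> j =
      ?p [^]\<^bsub>B\<^esub> (i * (int m - 2) + j * (int m - 1))" for i j :: int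
    using m by (simp add: B.int_pow_mult B.int_pow_pow p_closed of_nat_diff mult.commute
        flip: int_pow_int)
  have "bicyclic_sieving ?G ?c ?H ?d ?X (\<lambda>(g, h). g \<otimes>\<^bsub>B\<^esub> h) (psi m)"
    \<comment> \<open>Both groups are finite because their orders are positive.\<close>
    unfolding bicyclic_sieving_def order_G order_H
    using eval2_psi_eq_card_fixed[OF m] c_G d_H action finite_X order_G order_H m
    by (auto simp: B.int_pow_subgroup_generated pow_mult[unfolded One_nat_def] Coset.order_def
        card_ge_0_finite)
  moreover have "card {Q \<in> ?Orb. card Q = m - 2} = 1"
  proof -
    have "{k \<in> {..<m - 2}. orbit_length m k = m - 2} = {0}"
      using m by (auto simp: orbit_length_def)
    then show ?thesis
      by (simp add: card_orbits_of_size)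
  qed
  moreover have "card {Q \<in> ?Orb. card Q = m - 1} = m - 3"
  proof -
    have "{k \<in> {..<m - 2}. orbit_length m k = m - 1} = {1..<m - 2}"
      using m by (auto simp: orbit_length_def)
    then show ?thesis
      by (simp add: card_orbits_of_size)
  qed
  moreover have "\<forall>Q\<in>?Orb. card Q = m - 2 \<or> card Q = m - 1"
    by (auto simp: orbits_eq card_range_e orbit_length_def)
  ultimately show ?thesis
    using p_closed ord_p eval2_psi_eq_card_fixed[OF assms] by (simp add: Let_def)
qed

end
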